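(* Let $r\ge 1$ be an integer and let $a_1,\ldots,a_{r+1},b_1,\ldots,b_r,x,y$ be nonzero complex numbers such that the series below (with the inner series on the right expanded) converge absolutely. Then \begin{align*} &{ }_{r+1} \phi_{r+1}\left[\begin{array}{c}0, q/b_1,q/b_2,\cdots,q/b_r\\ q/a_1,q/a_2,\cdots,q/a_{r+1} \end{array}; q, \frac{qb_1b_2\cdots b_r}{ya_1a_2\cdots a_{r+1}}\right]\\ &=(x;q)_\infty\sum_{i,k\geq 0} \frac{x^kq^{ik}\tau(k)}{(q;q)_i(q,x; q)_k} \frac{(a_1,a_2,\cdots,a_{r+1};q)_{k-i}}{(b_1,b_2,\cdots,b_r;q)_{k-i}} y^{k-i}\\ &\qquad\times{ }_{r+1} \phi_{r}\left[\begin{array}{c} q^{k-i}a_1,q^{k-i}a_2,\cdots,q^{k-i}a_{r+1}\\ q^{k-i}b_1,q^{k-i}b_2,\cdots,q^{k-i}b_r \end{array}; q,xy\right]. \end{align*}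
   Context: $q$ is a complex number with $0<|q|<1$. Notation: $(a;q)_\infty=\prod_{k\ge 0}(1-aq^k)$ and $(a;q)_n=(a;q)_\infty/(aq^n;q)_\infty$ for $n\in\mathbb{Z}$, i.e. $(a;q)_n=\prod_{k=0}^{n-1}(1-aq^k)$ and $(a;q)_{-n}=1/\prod_{k=1}^{n}(1-aq^{-k})$ for $n\ge 0$; $(a_1,\ldots,a_m;q)_n=\prod_{k=1}^m (a_k;q)_n$; $\tau(n)=(-1)^nq^{n(n-1)/2}$. The basic hypergeometric series is $${}_{r}\phi_s\left[\begin{array}{c} a_1,\ldots,a_r\\ b_1,\ldots,b_s\end{array};q,x\right]=\sum_{n=0}^\infty\frac{(a_1,\ldots,a_r;q)_n}{(b_1,\ldots,b_s;q)_n}\tau(n)^{s+1-r}\frac{x^n}{(q;q)_n}.$$ All parameters are assumed to be such that no zero factors occur in denominators. *)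

theory Defs
  imports "HOL-Analysis.Infinite_Products" "HOL-Analysis.Infinite_Sum"
begin

definition qpoch_inf :: "complex \<Rightarrow> complex \<Rightarrow> complex" where
  "qpoch_inf a q = (\<Prod>k. 1 - a * q ^ k)"

text \<open>
  The finite products are used for $(a;q)_n$ rather than the quotient
  $(a;q)_\infty/(aq^n;q)_\infty$: the quotient is $0/0$ when $a = q^{-m}$ with $m \geq n \geq 0$,
  a value that is allowed for numerator parameters (terminating series).
\<close>

definition qpoch :: "complex \<Rightarrow> complex \<Rightarrow> int \<Rightarrow> complex" where
  "qpoch a q n =
     (if n \<ge> 0 then \<Prod>k<nat n. 1 - a * q ^ k
      else 1 / (\<Prod>k=1..nat (- n). 1 - a * q powi (- int k)))"

definition qpochs :: "complex list \<Rightarrow> complex \<Rightarrow> int \<Rightarrow> complex" where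
  "qpochs as q n = (\<Prod>a\<leftarrow>as. qpoch a q n)"

definition qtau :: "complex \<Rightarrow> nat \<Rightarrow> complex" where
  "qtau q n = (- 1) ^ n * q ^ (n * (n - 1) div 2)"

definition qhyper_term ::
    "complex list \<Rightarrow> complex list \<Rightarrow> complex \<Rightarrow> complex \<Rightarrow> nat \<Rightarrow> complex" where
  "qhyper_term as bs q x n =
     qpochs as q (int n) / qpochs bs q (int n)
       * qtau q n powi (int (length bs) + 1 - int (length as))
       * (x ^ n / qpoch q q (int n))"

definition qhyper :: "complex list \<Rightarrow> complex list \<Rightarrow> complex \<Rightarrow> complex \<Rightarrow> complex" where
  "qhyper as bs q x = (\<Sum>n. qhyper_term as bs q x n)"

end

theory Submission
  imports Defs "HOL-Computational_Algebra.Polynomial_FPS"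
begin

text \<open>
  Write \<open>c m = (a;q)_m / (b;q)_m * y^m\<close> for every integer \<open>m\<close>. The two sides of the identity are two
  expressions for a sum over the bilateral sequence \<open>c\<close>.

  On the left, reflecting each factor \<open>(a;q)_{-N}\<close> into \<open>(q/a;q)_N\<close> (lemma \<open>qpochs_uminus\<close>)
  turns the \<open>N\<close>-th term of the series into \<open>c (-N) / (q;q)_N\<close>. On the right, the rule
  \<open>(a;q)_{N+n} = (a;q)_N (a q^N;q)_n\<close> (lemma \<open>qpochs_add\<close>) merges the parameters of the inner
  series with their prefactor: the term with indices \<open>i, k, n\<close> is \<open>c (k + n - i)\<close> times the weight
  \<open>x^(k+n) q^(ik) \<tau>(k) / ((q)_i (q)_k (x)_k (q)_n)\<close>, in which neither \<open>a\<close>, \<open>b\<close> nor \<open>y\<close> occurs.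
  So it is enough to add up the weights along each fibre \<open>k + n - i = m\<close> and to see that
  \<open>(x;q)_\<infinity>\<close> times the result is \<open>1/(q;q)_{-m}\<close> for \<open>m \<le> 0\<close> and \<open>0\<close> for \<open>m > 0\<close>. This is
  lemma \<open>kernel_sum\<close>, the core of the proof.

  For \<open>kernel_sum\<close>, absorb the infinite product, \<open>(x)_\<infinity> / (x)_k = (x q^k)_\<infinity>\<close>, and expand it by the
  series of Euler in a fourth index \<open>j\<close>. Everything is now a power series in \<open>x\<close>, and the coefficient
  of \<open>x^T\<close>, with \<open>T = k + n + j\<close>, is a finite sum in which \<open>L = i + j = T - m\<close> is constant. The
  finite q-binomial theorem performs the sum over \<open>k\<close> and produces \<open>(q^L)_M / (q)_M\<close>, where
  \<open>M = k + n\<close>; these are the coefficients of \<open>1/(z;q)_L\<close>, whereas the remaining factors are those of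
  \<open>(z;q)_L / (q;q)_L\<close>. Their Cauchy product is \<open>1/(q;q)_L\<close>, so that only \<open>T = 0\<close>, \<open>L = -m\<close>
  survives.

  The rearrangements are legitimate because the triple series converges absolutely by hypothesis, and
  the four-index series for fixed \<open>m\<close> is dominated by a product of geometric series in \<open>|x|\<close>. That
  \<open>|x| < 1\<close> is itself a consequence of the hypothesis: the terms with \<open>k = 0\<close> and \<open>n = i\<close> have
  \<open>c 0 = 1\<close> and are \<open>x^i / (q;q)_i^2\<close>.
\<close>

section \<open>Shifted factorials with integer index\<close>

abbreviation qfac :: "complex \<Rightarrow> nat \<Rightarrow> complex" where
  "qfac q n \<equiv> qpoch q q (int n)"

lemma qpoch_of_nat: "qpoch a q (int n) = (\<Prod>k<n. 1 - a * q ^ k)"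
  by (simp add: qpoch_def)

lemma qpoch_Suc: "qpoch a q (int (Suc n)) = qpoch a q (int n) * (1 - a * q ^ n)"
  unfolding qpoch_of_nat by simp

lemma qpoch_0 [simp]: "qpoch a q 0 = 1"
  by (simp add: qpoch_def)

lemma qfac_Suc: "qfac q (Suc n) = qfac q n * (1 - q ^ Suc n)"
  by (simp only: qpoch_Suc power_Suc)

lemma qtau_0 [simp]: "qtau q 0 = 1"
  by (simp add: qtau_def)

lemma qtau_Suc: "qtau q (Suc n) = - (qtau q n * q ^ n)"
proof -
  have "Suc n * (Suc n - 1) div 2 = n * (n - 1) div 2 + n"
    by (cases n) simp_all
  then show ?thesis
    unfolding qtau_def by (simp only: power_add power_Suc) simp
qed

lemma norm_qtau_le_1: "norm q < 1 \<Longrightarrow> norm (qtau q n) \<le> 1"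
  unfolding qtau_def by (simp add: norm_mult norm_power power_le_one)

lemma qpoch_nonzero:
  assumes "norm q < 1" "norm z < 1"
  shows "qpoch z q (int n) \<noteq> 0"
proof -
  have "1 - z * q ^ k \<noteq> 0" for k
  proof
    assume "1 - z * q ^ k = 0"
    then have "norm (z * q ^ k) = 1" by (metis eq_iff_diff_eq_0 norm_one)
    moreover have "norm (z * q ^ k) \<le> norm z"
      using assms by (simp add: norm_mult norm_power mult_left_le power_le_one)
    ultimately show False using assms by simp
  qed
  then show ?thesis by (simp add: qpoch_of_nat)
qed

text \<open>
The one-step recursion through all integers is what glues the two branches of the definition together;
the shift and the reflection formulas both follow from it by induction.
\<close>

lemma qpoch_step:
  assumes "q \<noteq> 0" and "\<And>k. 1 - a * q powi (- int (Suc k)) \<noteq> 0"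
  shows "qpoch a q (N + 1) = qpoch a q N * (1 - a * q powi N)"
proof (cases "N \<ge> 0")
  case True
  then obtain n where "N = int n" using nonneg_int_cases by blast
  then show ?thesis using qpoch_Suc[of a q n] by (simp add: add.commute)
next
  case False
  then obtain p where N: "N = - int (Suc p)"
    by (metis int_cases not_less negative_zless linorder_linear int_nat_eq nat_int of_nat_0_le_iff)
  have "qpoch a q N = 1 / (\<Prod>k=1..Suc p. 1 - a * q powi (- int k))"
    unfolding N qpoch_def by (simp del: of_nat_Suc)
  moreover have "qpoch a q (N + 1) = 1 / (\<Prod>k=1..p. 1 - a * q powi (- int k))"
    unfolding N qpoch_def by simp
  ultimately show ?thesis
    \<comment> \<open>The last factor of the longer denominator cancels.\<close>
    using assms(2)[of p] unfolding N by (simp del: of_nat_Suc)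
qed

lemma qpoch_add:
  assumes "q \<noteq> 0" and "\<And>k. 1 - a * q powi (- int (Suc k)) \<noteq> 0"
  shows "qpoch a q (N + int n) = qpoch a q N * qpoch (q powi N * a) q (int n)"
proof (induction n)
  case (Suc n)
  have "qpoch a q (N + int (Suc n)) = qpoch a q ((N + int n) + 1)"
    by (simp add: algebra_simps)
  also have "\<dots> = qpoch a q (N + int n) * (1 - a * q powi (N + int n))"
    by (rule qpoch_step[OF assms])
  finally show ?case
    using assms(1) unfolding Suc qpoch_Suc by (simp add: power_int_add mult_ac)
qed simp

lemma qpochs_add:
  assumes "q \<noteq> 0" and "\<And>\<alpha> k. \<alpha> \<in> set as \<Longrightarrow> 1 - \<alpha> * q powi (- int (Suc k)) \<noteq> 0"
  shows "qpochs as q (N + int n)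
    = qpochs as q N * qpochs (map (\<lambda>\<alpha>. q powi N * \<alpha>) as) q (int n)"
  using assms(2)
proof (induction as)
  case (Cons \<alpha> as)
  then show ?case
    using qpoch_add[OF assms(1), of \<alpha> N n] by (simp add: qpochs_def mult_ac)
qed (simp add: qpochs_def)

text \<open>
Reflection: each factor \<open>1 - a q^(-k)\<close> in the denominator of \<open>(a;q)_{-n}\<close> is
\<open>- a q^(-k) (1 - (q/a) q^(k-1))\<close>, and the accumulated monomials form \<open>\<tau>(n) (q/a)^n\<close>.
\<close>

lemma qpoch_uminus:
  assumes "q \<noteq> 0" "a \<noteq> 0" and "\<And>k. 1 - a * q powi (- int (Suc k)) \<noteq> 0"
  shows "qpoch a q (- int n) * qpoch (q / a) q (int n) = qtau q n * (q / a) ^ n"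
proof (induction n)
  case (Suc n)
  have "qpoch a q (- int n) = qpoch a q (- int (Suc n)) * (1 - a * q powi (- int (Suc n)))"
    using qpoch_step[OF assms(1,3), of "- int (Suc n)"] by simp
  moreover have "1 - q / a * q ^ n = - (q ^ Suc n / a) * (1 - a * q powi (- int (Suc n)))"
    using assms(1,2) by (simp add: power_int_minus field_simps del: of_nat_Suc)
  ultimately have "qpoch a q (- int (Suc n)) * qpoch (q / a) q (int (Suc n))
      = - (q ^ Suc n / a) * (qpoch a q (- int n) * qpoch (q / a) q (int n))"
    unfolding qpoch_Suc by (simp add: mult_ac)
  then show ?case unfolding Suc qtau_Suc by (simp add: field_simps)
qed simp

lemma qpochs_uminus:
  assumes "q \<noteq> 0" "\<And>\<alpha>. \<alpha> \<in> set as \<Longrightarrow> \<alpha> \<noteq> 0"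
    and "\<And>\<alpha> k. \<alpha> \<in> set as \<Longrightarrow> 1 - \<alpha> * q powi (- int (Suc k)) \<noteq> 0"
  shows "qpochs as q (- int n) * qpochs (map (\<lambda>\<alpha>. q / \<alpha>) as) q (int n)
    = (qtau q n * q ^ n) ^ length as / prod_list as ^ n"
  using assms(2,3)
proof (induction as)
  case (Cons \<alpha> as)
  have "qpochs (\<alpha> # as) q (- int n) * qpochs (map (\<lambda>\<alpha>. q / \<alpha>) (\<alpha> # as)) q (int n)
    = (qpoch \<alpha> q (- int n) * qpoch (q / \<alpha>) q (int n))
      * (qpochs as q (- int n) * qpochs (map (\<lambda>\<alpha>. q / \<alpha>) as) q (int n))"
    by (simp add: qpochs_def mult_ac)
  also have "\<dots> = (qtau q n * (q / \<alpha>) ^ n) * ((qtau q n * q ^ n) ^ length as / prod_list as ^ n)"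
    using Cons qpoch_uminus[OF assms(1), of \<alpha> n] by simp
  finally show ?case by (simp add: power_divide power_mult_distrib)
qed (simp add: qpochs_def)

section \<open>The finite q-binomial theorem and its reciprocal\<close>

text \<open>
The finite q-binomial theorem in coefficient form, by the Pascal rule for Gaussian binomials. It is
stated for the polynomial because it is needed twice: evaluated at a number, and as a formal power
series that has a reciprocal.
\<close>

lemma coeff_qpoch_poly:
  assumes "\<And>n. qfac q n \<noteq> 0"
  shows "coeff (\<Prod>k<L. [:1, - (q ^ k):]) j
    = (if j \<le> L then qfac q L * qtau q j / (qfac q j * qfac q (L - j)) else 0)"
proof (induction L arbitrary: j)
  case 0
  then show ?case by (simp add: if_distrib coeff_1)
next
  case (Suc L)
  let ?P = "\<lambda>L. \<Prod>k<L. [:1, - (q ^ k):]"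
  have nz: "1 - q ^ Suc n \<noteq> 0" for n using assms[of "Suc n"] unfolding qfac_Suc by simp
  have P: "?P (Suc L) = ?P L + pCons 0 (smult (- (q ^ L)) (?P L))"
    by (simp add: mult.commute[of _ "[:1, - (q ^ L):]"])
  show ?case
  proof (cases j)
    case 0
    then show ?thesis using Suc[of 0] assms unfolding P by (simp del: of_nat_Suc)
  next
    case (Suc i)
    have c: "coeff (?P (Suc L)) j = coeff (?P L) (Suc i) - q ^ L * coeff (?P L) i"
      unfolding P Suc by simp
    \<comment> \<open>With \<open>L = i + 1 + d\<close> the Pascal rule amounts to
      \<open>q^i (1 - q^(d+1)) + q^L (1 - q^(i+1)) = q^i (1 - q^(L+1))\<close>.\<close>
    consider "Suc i \<le> L" | "i = L" | "i > L" by linarith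
    then show ?thesis
    proof cases
      case 1
      then obtain d where d: "L = Suc i + d" using le_Suc_ex by blast
      show ?thesis
        unfolding c Suc.IH using assms[of i] assms[of d] nz[of i] nz[of d] nz[of L] assms[of L] \<open>j = Suc i\<close> d
        by (simp add: qfac_Suc qtau_Suc Suc_diff_le power_add divide_simps del: of_nat_Suc power_Suc)
           (simp add: algebra_simps power_add)
    next
      case 2
      then show ?thesis unfolding c Suc.IH using assms \<open>j = Suc i\<close> by (simp add: qtau_Suc del: of_nat_Suc)
    next
      case 3
      then show ?thesis unfolding c Suc.IH using \<open>j = Suc i\<close> by simp
    qed
  qed
qed

lemma finite_qbinomial:
  assumes "\<And>n. qfac q n \<noteq> 0"
  shows "(\<Sum>k\<le>M. z ^ k * qtau q k / (qfac q k * qfac q (M - k))) = qpoch z q (int M) / qfac q M"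
proof -
  let ?P = "\<Prod>k<M. [:1, - (q ^ k):]"
  have "degree ?P \<le> M"
    using coeff_qpoch_poly[OF assms] by (intro degree_le) auto
  then have "poly ?P z = (\<Sum>k\<le>M. coeff ?P k * z ^ k)"
    unfolding poly_altdef by (intro sum.mono_neutral_left) (auto simp: coeff_eq_0)
  also have "\<dots> = qfac q M * (\<Sum>k\<le>M. z ^ k * qtau q k / (qfac q k * qfac q (M - k)))"
    unfolding sum_distrib_left by (intro sum.cong) (simp_all add: coeff_qpoch_poly[OF assms])
  also have "poly ?P z = qpoch z q (int M)"
    by (simp add: qpoch_of_nat poly_prod mult.commute)
  finally show ?thesis using assms by (simp add: field_simps)
qed

text \<open>
The expansion of \<open>1/(z;q)_L\<close>, i.e. the q-binomial theorem for a terminating product. Multiplying the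
claimed series \<open>H (L + 1)\<close> by the additional factor \<open>1 - q^L z\<close> gives back \<open>H L\<close>.
\<close>

lemma fps_qpoch_mult_inverse:
  assumes "\<And>n. qfac q n \<noteq> 0"
  shows "fps_of_poly (\<Prod>k<L. [:1, - (q ^ k):])
    * Abs_fps (\<lambda>M. qpoch (q ^ L) q (int M) / qfac q M) = 1"
proof (induction L)
  case 0
  \<comment> \<open>The factor with exponent 0 vanishes, hence the series for \<open>L = 0\<close> is the constant 1.\<close>
  have "qpoch 1 q (int (Suc p)) = 0" for p
    unfolding qpoch_of_nat prod.lessThan_Suc_shift by simp
  then have "qpoch 1 q (int M) = (if M = 0 then 1 else 0)" for M
    by (cases M) (simp_all del: of_nat_Suc)
  then show ?case by (intro fps_ext) simp
next
  case (Suc L)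
  let ?H = "\<lambda>L. Abs_fps (\<lambda>M. qpoch (q ^ L) q (int M) / qfac q M)"
  have nz: "1 - q ^ Suc n \<noteq> 0" for n using assms[of "Suc n"] unfolding qfac_Suc by simp
  have "fps_of_poly [:1, - (q ^ L):] * ?H (Suc L) = ?H L"
  proof (rule fps_ext)
    fix M
    show "fps_nth (fps_of_poly [:1, - (q ^ L):] * ?H (Suc L)) M = fps_nth (?H L) M"
    proof (cases M)
      case 0
      then show ?thesis by simp
    next
      case (Suc p)
      have s: "qpoch (q ^ L) q (int (Suc p)) = (1 - q ^ L) * qpoch (q ^ Suc L) q (int p)"
        unfolding qpoch_of_nat prod.lessThan_Suc_shift by (simp add: mult_ac)
      have "fps_nth (fps_of_poly [:1, - (q ^ L):] * ?H (Suc L)) M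
          = fps_nth (?H (Suc L)) (Suc p) - q ^ L * fps_nth (?H (Suc L)) p"
        unfolding Suc by (simp add: fps_of_poly_pCons algebra_simps)
      also have "\<dots> = fps_nth (?H L) (Suc p)"
        unfolding fps_nth_Abs_fps s qpoch_Suc[of "q ^ Suc L"] qfac_Suc using nz[of p] assms[of p]
        by (simp add: field_simps)
      finally show ?thesis unfolding Suc .
    qed
  qed
  then show ?case
    unfolding prod.lessThan_Suc fps_of_poly_mult mult.assoc using Suc by (simp only:)
qed

text \<open>
This is \<open>(z;q)_L / (q;q)_L * 1/(z;q)_L = 1/(q;q)_L\<close>, read off at \<open>z^T\<close>.
\<close>

lemma qpoch_convolution_inverse:
  assumes "\<And>n. qfac q n \<noteq> 0"
  shows "(\<Sum>j\<in>{j. j \<le> T \<and> j \<le> L}. qtau q j / (qfac q j * qfac q (L - j))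
      * (qpoch (q ^ L) q (int (T - j)) / qfac q (T - j))) = (if T = 0 then 1 / qfac q L else 0)"
    (is "?S = _")
proof -
  have "qfac q L * ?S = (\<Sum>j=0..T. coeff (\<Prod>k<L. [:1, - (q ^ k):]) j
      * (qpoch (q ^ L) q (int (T - j)) / qfac q (T - j)))"
    unfolding sum_distrib_left
    by (intro sum.mono_neutral_cong_left) (auto simp: coeff_qpoch_poly[OF assms])
  also have "\<dots> = fps_nth (1 :: complex fps) T"
    unfolding fps_qpoch_mult_inverse[OF assms, of L, symmetric] fps_mult_nth by simp
  finally show ?thesis using assms[of L] by (simp add: field_simps split: if_splits)
qed

section \<open>Infinite products and the series of Euler\<close>

lemma
  assumes "norm q < 1"
  shows convergent_prod_qpoch: "convergent_prod (\<lambda>k. 1 - z * q ^ k)"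
    and qpoch_LIMSEQ: "(\<lambda>n. qpoch z q (int n)) \<longlonglongrightarrow> qpoch_inf z q"
proof -
  have "summable (\<lambda>k. norm z * norm q ^ k)"
    using assms by (intro summable_mult summable_geometric) simp
  then have "abs_convergent_prod (\<lambda>k. 1 - z * q ^ k)"
    by (intro summable_imp_abs_convergent_prod) (simp add: norm_mult norm_power)
  then show conv: "convergent_prod (\<lambda>k. 1 - z * q ^ k)"
    by (rule abs_convergent_prod_imp_convergent_prod)
  show "(\<lambda>n. qpoch z q (int n)) \<longlonglongrightarrow> qpoch_inf z q"
    using convergent_prod_LIMSEQ[OF conv]
    unfolding qpoch_of_nat qpoch_inf_def LIMSEQ_lessThan_iff_atMost .
qed

lemma qfac_nonzero: "norm q < 1 \<Longrightarrow> qfac q n \<noteq> 0"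
  by (rule qpoch_nonzero)

text \<open>
The products converge to a nonzero limit, so their reciprocals stay bounded. For \<open>z = q\<close> this
replaces every reciprocal factorial by a constant when series are compared with geometric ones.
\<close>

lemma qpoch_inverse_bounded:
  assumes "norm q < 1" "norm z < 1"
  obtains C where "C > 0" "\<And>n. norm (inverse (qpoch z q (int n))) \<le> C"
proof -
  have nz: "1 - z * q ^ k \<noteq> 0" for k
    using qpoch_nonzero[OF assms, of "Suc k"] unfolding qpoch_Suc by simp
  have "qpoch_inf z q \<noteq> 0"
    unfolding qpoch_inf_def
    using convergent_prod_qpoch[OF assms(1)] nz by (rule prodinf_nonzero)
  then have "(\<lambda>n. inverse (qpoch z q (int n))) \<longlonglongrightarrow> inverse (qpoch_inf z q)"
    using qpoch_LIMSEQ[OF assms(1)] by (intro tendsto_inverse)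
  then have "Bseq (\<lambda>n. inverse (qpoch z q (int n)))"
    by (intro convergent_imp_Bseq convergentI)
  then show ?thesis
    using that unfolding Bseq_def by blast
qed

lemma euler_series_summable:
  assumes "norm q < 1" "norm z < 1"
  shows "summable (\<lambda>j. norm (qtau q j / qfac q j * z ^ j))"
proof -
  obtain C where C: "C > 0" "\<And>n. norm (inverse (qfac q n)) \<le> C"
    using qpoch_inverse_bounded[OF assms(1,1)] by blast
  show ?thesis
  proof (rule summable_comparison_test_ev)
    have "norm (norm (qtau q j / qfac q j * z ^ j)) \<le> C * norm z ^ j" for j
      using mult_mono[OF norm_qtau_le_1[OF assms(1), of j] C(2)[of j]]
      by (simp add: norm_mult norm_power norm_divide norm_inverse mult_right_mono divide_inverse)
    then show "\<forall>\<^sub>F j in sequentially. norm (norm (qtau q j / qfac q j * z ^ j)) \<le> C * norm z ^ j"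
      by simp
    show "summable (\<lambda>j. C * norm z ^ j)"
      using assms by (intro summable_mult summable_geometric) simp
  qed
qed

text \<open>
The series \<open>E\<close> satisfies the functional equation \<open>E z = (1 - z) E (z q)\<close> of the infinite product.
Iterating it, \<open>E z = (z;q)_n E (z q^n)\<close>, and letting \<open>n\<close> tend to infinity identifies \<open>E\<close> with the
product, since \<open>E\<close> is continuous at \<open>0\<close> with value \<open>1\<close>.
\<close>

lemma euler_expansion:
  assumes "norm q < 1" "norm z < 1"
  shows "((\<lambda>j. qtau q j / qfac q j * z ^ j) has_sum qpoch_inf z q) UNIV"
proof -
  define e where "e j = qtau q j / qfac q j" for j
  define E where "E z = (\<Sum>j. e j * z ^ j)" for z
  have sm: "summable (\<lambda>j. e j * w ^ j)" if "norm w < 1" for w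
    using euler_series_summable[OF assms(1) that] unfolding e_def by (rule summable_norm_cancel)
  have e_Suc: "e (Suc j) - q ^ Suc j * e (Suc j) = - (q ^ j * e j)" for j
  proof -
    have "1 - q ^ Suc j \<noteq> 0"
      using qfac_nonzero[OF assms(1), of "Suc j"] unfolding qfac_Suc by simp
    then have "e (Suc j) * (1 - q ^ Suc j) = - (q ^ j * e j)"
      unfolding e_def qtau_Suc qfac_Suc by (simp add: divide_inverse del: power_Suc)
    then show ?thesis by (simp add: algebra_simps)
  qed
  have step: "E w = (1 - w) * E (w * q)" if w: "norm w < 1" for w
  proof -
    have wq: "norm (w * q) < 1"
      using mult_left_le[of "norm q" "norm w"] w assms(1) by (simp add: norm_mult)
    have s1: "(\<lambda>j. e (Suc j) * w ^ Suc j) sums (E w - e 0)"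
      using summable_sums[OF sm[OF w]] unfolding E_def by (subst sums_Suc_iff) simp
    have s2: "(\<lambda>j. e (Suc j) * (w * q) ^ Suc j) sums (E (w * q) - e 0)"
      using summable_sums[OF sm[OF wq]] unfolding E_def by (subst sums_Suc_iff) simp
    have s3: "(\<lambda>j. - w * (e j * (w * q) ^ j)) sums (- w * E (w * q))"
      using sums_mult[OF summable_sums[OF sm[OF wq]], of "- w"] unfolding E_def .
    have "e (Suc j) * w ^ Suc j - e (Suc j) * (w * q) ^ Suc j = - w * (e j * (w * q) ^ j)" for j
    proof -
      have "e (Suc j) * w ^ Suc j - e (Suc j) * (w * q) ^ Suc j
          = w ^ Suc j * (e (Suc j) - q ^ Suc j * e (Suc j))"
        by (simp add: power_mult_distrib algebra_simps)
      then show ?thesis unfolding e_Suc by (simp add: power_mult_distrib)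
    qed
    then have "(E w - e 0) - (E (w * q) - e 0) = - w * E (w * q)"
      using sums_unique2[OF sums_diff[OF s1 s2]] s3 by simp
    then show ?thesis by (simp add: algebra_simps)
  qed
  have zq: "norm (z * q ^ n) < 1" for n
    using assms mult_left_le[of "norm q ^ n" "norm z"] by (simp add: norm_mult norm_power power_le_one)
  have iter: "E z = qpoch z q (int n) * E (z * q ^ n)" for n
  proof (induction n)
    case (Suc n)
    have "E (z * q ^ n) = (1 - z * q ^ n) * E (z * q ^ Suc n)"
      using step[OF zq[of n]] by (simp add: mult_ac)
    then show ?case using Suc unfolding qpoch_Suc by simp
  qed simp
  have "isCont E 0"
    \<comment> \<open>Any radius strictly between 0 and 1 would do in place of \<open>1/2\<close>.\<close>
    unfolding E_def by (rule isCont_powser[OF sm[of "1/2"]]) simp_all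
  moreover have "(\<lambda>n. z * q ^ n) \<longlonglongrightarrow> 0"
    using tendsto_mult_right_zero[OF LIMSEQ_power_zero[OF assms(1)]] .
  ultimately have "(\<lambda>n. E (z * q ^ n)) \<longlonglongrightarrow> E 0"
    by (rule isCont_tendsto_compose)
  moreover have "E 0 = 1"
    unfolding E_def powser_zero by (simp add: e_def)
  ultimately have "(\<lambda>n. qpoch z q (int n) * E (z * q ^ n)) \<longlonglongrightarrow> qpoch_inf z q * 1"
    using qpoch_LIMSEQ[OF assms(1)] by (intro tendsto_mult) simp_all
  then have "E z = qpoch_inf z q"
    unfolding iter[symmetric] by (simp add: LIMSEQ_const_iff)
  then have "(\<lambda>j. e j * z ^ j) sums qpoch_inf z q"
    using summable_sums[OF sm[OF assms(2)]] unfolding E_def by simp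
  then show ?thesis
    using norm_summable_imp_has_sum[OF euler_series_summable[OF assms]] unfolding e_def by blast
qed

lemma qpoch_inf_split:
  assumes "norm q < 1"
  shows "qpoch_inf z q = qpoch z q (int n) * qpoch_inf (z * q ^ n) q"
proof -
  have "qpoch z q (int (m + n)) = qpoch z q (int n) * qpoch (z * q ^ n) q (int m)" for m
    by (induction m) (simp_all add: qpoch_Suc power_add mult_ac del: of_nat_Suc of_nat_add)
  then have "(\<lambda>m. qpoch z q (int n) * qpoch (z * q ^ n) q (int m)) \<longlonglongrightarrow> qpoch_inf z q"
    using LIMSEQ_ignore_initial_segment[OF qpoch_LIMSEQ[OF assms], of z n] by simp
  moreover have "(\<lambda>m. qpoch z q (int n) * qpoch (z * q ^ n) q (int m))
      \<longlonglongrightarrow> qpoch z q (int n) * qpoch_inf (z * q ^ n) q"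
    by (intro tendsto_mult tendsto_const qpoch_LIMSEQ[OF assms])
  ultimately show ?thesis by (rule LIMSEQ_unique)
qed

section \<open>The coefficient of a single bilateral term\<close>

lemma geometric_product_summable:
  fixes t :: real
  assumes "0 \<le> t" "t < 1"
  shows "(\<lambda>((k, n), j). t ^ k * t ^ n * t ^ j) summable_on UNIV"
proof -
  have geom: "((\<lambda>n. t ^ n) has_sum (1 / (1 - t))) UNIV"
    using assms by (intro norm_summable_imp_has_sum geometric_sums) (simp_all add: norm_power summable_geometric)
  have "(\<lambda>(k, n). t ^ k * t ^ n) summable_on (UNIV \<times> UNIV)"
  proof (rule summable_on_SigmaI)
    show "((\<lambda>n. case (k, n) of (k, n) \<Rightarrow> t ^ k * t ^ n) has_sum t ^ k * (1 / (1 - t))) UNIV" for k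
      using has_sum_cmult_right[OF geom, of "t ^ k"] by simp
    show "(\<lambda>k. t ^ k * (1 / (1 - t))) summable_on UNIV"
      using has_sum_cmult_left[OF geom] by (rule has_sum_imp_summable)
  qed (use assms in auto)
  then have pairs: "(\<lambda>p. (case p of (k, n) \<Rightarrow> t ^ k * t ^ n) * (1 / (1 - t))) summable_on UNIV"
    by (intro summable_on_cmult_left) simp
  have "(\<lambda>((k, n), j). t ^ k * t ^ n * t ^ j) summable_on (UNIV \<times> UNIV)"
  proof (rule summable_on_SigmaI[OF _ pairs])
    show "((\<lambda>j. (\<lambda>((k, n), j). t ^ k * t ^ n * t ^ j) (p, j))
        has_sum (case p of (k, n) \<Rightarrow> t ^ k * t ^ n) * (1 / (1 - t))) UNIV" for p
      using has_sum_cmult_right[OF geom, of "t ^ fst p * t ^ snd p"] by (simp add: case_prod_unfold)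
  qed (use assms in auto)
  then show ?thesis by simp
qed

text \<open>
The general term, with indices \<open>i\<close>, \<open>k\<close>, \<open>n\<close>, \<open>j\<close>, obtained from the weight of \<open>(i, k, n)\<close> by
expanding \<open>(x q^k;q)_\<infinity>\<close> with summation index \<open>j\<close>. On a fibre the index \<open>i\<close> is determined by \<open>k\<close> and \<open>n\<close>;
it remains a parameter, which keeps the term a product of powers and factorials.
\<close>

definition quad_term :: "complex \<Rightarrow> complex \<Rightarrow> nat \<Rightarrow> nat \<Rightarrow> nat \<Rightarrow> nat \<Rightarrow> complex" where
  "quad_term q x i k n j = x ^ (k + n + j) * q ^ ((i + j) * k) * qtau q k * qtau q j
     / (qfac q i * qfac q k * qfac q n * qfac q j)"

text \<open>
All powers of \<open>q\<close> have nonnegative exponents, so they are bounded by 1, and the four reciprocal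
factorials are bounded by a constant; the geometric factors in \<open>x\<close> remain.
\<close>

lemma quad_term_summable:
  assumes "norm q < 1" "norm x < 1"
  shows "(\<lambda>((k, n), j). quad_term q x (i k n) k n j) summable_on A"
proof -
  obtain C where C: "C > 0" "\<And>n. norm (inverse (qfac q n)) \<le> C"
    using qpoch_inverse_bounded[OF assms(1,1)] by blast
  have bound: "norm (quad_term q x (i k n) k n j) \<le> C ^ 4 * (norm x ^ k * norm x ^ n * norm x ^ j)" for k n j
  proof -
    have "norm (q ^ ((i k n + j) * k) * qtau q k * qtau q j) \<le> 1 * 1 * 1"
      unfolding norm_mult using norm_qtau_le_1[OF assms(1)] assms(1)
      by (intro mult_mono) (simp_all add: norm_power power_le_one mult_le_one)
    moreover have "norm (inverse (qfac q (i k n)) * inverse (qfac q k) * inverse (qfac q n) * inverse (qfac q j))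
        \<le> C * C * C * C"
      unfolding norm_mult using C by (intro mult_mono) auto
    ultimately have "norm (q ^ ((i k n + j) * k) * qtau q k * qtau q j)
        * norm (inverse (qfac q (i k n)) * inverse (qfac q k) * inverse (qfac q n) * inverse (qfac q j))
        \<le> 1 * (C * C * C * C)"
      using C(1) by (intro mult_mono) auto
    then have "(norm x ^ k * norm x ^ n * norm x ^ j) * (norm (q ^ ((i k n + j) * k) * qtau q k * qtau q j)
        * norm (inverse (qfac q (i k n)) * inverse (qfac q k) * inverse (qfac q n) * inverse (qfac q j)))
        \<le> (norm x ^ k * norm x ^ n * norm x ^ j) * (1 * (C * C * C * C))"
      by (intro mult_left_mono) auto
    moreover have "norm (quad_term q x (i k n) k n j)
        = (norm x ^ k * norm x ^ n * norm x ^ j) * (norm (q ^ ((i k n + j) * k) * qtau q k * qtau q j)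
        * norm (inverse (qfac q (i k n)) * inverse (qfac q k) * inverse (qfac q n) * inverse (qfac q j)))"
      unfolding quad_term_def by (simp add: norm_mult norm_power power_add divide_inverse norm_inverse)
    ultimately show ?thesis by (simp add: power4_eq_xxxx mult_ac)
  qed
  have "(\<lambda>p. C ^ 4 * (\<lambda>((k, n), j). norm x ^ k * norm x ^ n * norm x ^ j) p) summable_on UNIV"
    by (rule summable_on_cmult_right[OF geometric_product_summable[OF norm_ge_zero assms(2)]])
  then have "(\<lambda>((k, n), j). quad_term q x (i k n) k n j) abs_summable_on UNIV"
    by (rule abs_summable_on_comparison_test') (use bound in \<open>auto simp: case_prod_unfold\<close>)
  then show ?thesis
    using abs_summable_summable summable_on_subset_banach by blast
qed

text \<open>
The homogeneous part of degree \<open>T\<close> in \<open>x\<close>. Here \<open>i + j = T - m\<close> is constant, which decouples the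
sum over \<open>k\<close> from the sum over \<open>j\<close>: the former is an instance of the finite q-binomial theorem at
\<open>z = q^L\<close>, the latter the convolution of \<open>(z;q)_L\<close> with its reciprocal.
\<close>

lemma quad_term_graded_sum:
  fixes m :: int and T :: nat
  assumes "norm q < 1"
  defines "F \<equiv> {((k, n), j). k + n + j = T \<and> int k + int n \<ge> m}"
  shows "finite F"
    and "(\<Sum>((k, n), j)\<in>F. quad_term q x (nat (int k + int n - m)) k n j)
      = (if T = 0 \<and> m \<le> 0 then 1 / qfac q (nat (- m)) else 0)"
proof -
  have "F \<subseteq> ({..T} \<times> {..T}) \<times> {..T}" unfolding F_def by auto
  then show "finite F" by (rule finite_subset) auto
  note nz = qfac_nonzero[OF assms(1)]
  show "(\<Sum>((k, n), j)\<in>F. quad_term q x (nat (int k + int n - m)) k n j)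
      = (if T = 0 \<and> m \<le> 0 then 1 / qfac q (nat (- m)) else 0)"
  proof (cases "m \<le> int T")
    case False
    then have "F = {}" unfolding F_def by auto
    then show ?thesis using False by auto
  next
    case True
    \<comment> \<open>The common value of \<open>i + j\<close>; the constraint \<open>i \<ge> 0\<close> becomes \<open>j \<le> L\<close>.\<close>
    define L where "L = nat (int T - m)"
    define J where "J = {j. j \<le> T \<and> j \<le> L}"
    have "finite J" unfolding J_def by auto
    have L: "int L = int T - m" using True unfolding L_def by simp
    have "(\<Sum>((k, n), j)\<in>F. quad_term q x (nat (int k + int n - m)) k n j)
        = (\<Sum>(j, k)\<in>Sigma J (\<lambda>j. {..T - j}). quad_term q x (L - j) k (T - j - k) j)"
    proof (rule sum.reindex_bij_witness[where j = "\<lambda>((k, n), j). (j, k)" and i = "\<lambda>(j, k). ((k, T - j - k), j)"])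
      fix p assume "p \<in> F"
      then obtain k n j where p: "p = ((k, n), j)" "k + n + j = T" "int k + int n \<ge> m"
        unfolding F_def by auto
      have "nat (int k + int n - m) = L - j" using p L by linarith
      then show "(\<lambda>(j, k). quad_term q x (L - j) k (T - j - k) j) ((\<lambda>((k, n), j). (j, k)) p)
          = (\<lambda>((k, n), j). quad_term q x (nat (int k + int n - m)) k n j) p"
        using p by auto
    qed (use L in \<open>auto simp: F_def J_def\<close>)
    also have "\<dots> = (\<Sum>j\<in>J. \<Sum>k\<le>T - j. quad_term q x (L - j) k (T - j - k) j)"
      using \<open>finite J\<close> by (intro sum.Sigma[symmetric]) auto
    also have "\<dots> = (\<Sum>j\<in>J. x ^ T * (qtau q j / (qfac q j * qfac q (L - j))
        * (qpoch (q ^ L) q (int (T - j)) / qfac q (T - j))))"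
    proof (rule sum.cong[OF refl])
      fix j assume j: "j \<in> J"
      have "quad_term q x (L - j) k (T - j - k) j = x ^ T * (qtau q j / (qfac q j * qfac q (L - j)))
          * ((q ^ L) ^ k * qtau q k / (qfac q k * qfac q (T - j - k)))" if "k \<le> T - j" for k
      proof -
        have "k + (T - j - k) + j = T" "L - j + j = L" using j that unfolding J_def by auto
        then show ?thesis unfolding quad_term_def by (simp add: power_mult mult_ac)
      qed
      then have "(\<Sum>k\<le>T - j. quad_term q x (L - j) k (T - j - k) j)
          = x ^ T * (qtau q j / (qfac q j * qfac q (L - j)))
            * (\<Sum>k\<le>T - j. (q ^ L) ^ k * qtau q k / (qfac q k * qfac q (T - j - k)))"
        unfolding sum_distrib_left by simp
      then show "(\<Sum>k\<le>T - j. quad_term q x (L - j) k (T - j - k) j)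
          = x ^ T * (qtau q j / (qfac q j * qfac q (L - j))
            * (qpoch (q ^ L) q (int (T - j)) / qfac q (T - j)))"
        unfolding finite_qbinomial[OF nz] by (simp only: mult.assoc)
    qed
    also have "\<dots> = x ^ T * (if T = 0 then 1 / qfac q L else 0)"
      unfolding sum_distrib_left[symmetric] J_def qpoch_convolution_inverse[OF nz] ..
    also have "\<dots> = (if T = 0 \<and> m \<le> 0 then 1 / qfac q (nat (- m)) else 0)"
      using True unfolding L_def by auto
    finally show ?thesis .
  qed
qed

lemma quad_term_sum:
  fixes m :: int
  assumes "norm q < 1" "norm x < 1"
  defines "K \<equiv> {(k, n). int k + int n \<ge> m}"
  shows "(\<Sum>\<^sub>\<infinity>((k, n), j)\<in>K \<times> UNIV. quad_term q x (nat (int k + int n - m)) k n j)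
    = (if m \<le> 0 then 1 / qfac q (nat (- m)) else 0)"
proof -
  let ?f = "\<lambda>((k, n), j). quad_term q x (nat (int k + int n - m)) k n j"
  define F where "F T = {((k, n), j). k + n + j = T \<and> int k + int n \<ge> m}" for T :: nat
  have bij: "bij_betw snd (Sigma UNIV F) (K \<times> UNIV)"
    unfolding F_def K_def by (rule bij_betwI[where g = "\<lambda>((k, n), j). (k + n + j, ((k, n), j))"]) auto
  have sm: "(\<lambda>p. ?f (snd p)) summable_on Sigma UNIV F"
    using quad_term_summable[OF assms(1,2), of "\<lambda>k n. nat (int k + int n - m)" "K \<times> UNIV"]
    by (subst summable_on_reindex_bij_betw[OF bij])
  have graded: "(\<Sum>\<^sub>\<infinity>p\<in>F T. ?f p) = (if T = 0 \<and> m \<le> 0 then 1 / qfac q (nat (- m)) else 0)" for T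
    unfolding F_def
    using quad_term_graded_sum(1)[of q T m] quad_term_graded_sum(2)[of q x m T] assms(1)
    by (simp only: infsum_finite)
  have "infsum ?f (K \<times> UNIV) = infsum (\<lambda>p. ?f (snd p)) (Sigma UNIV F)"
    by (rule infsum_reindex_bij_betw[OF bij, symmetric])
  also have "\<dots> = (\<Sum>\<^sub>\<infinity>T. \<Sum>\<^sub>\<infinity>p\<in>F T. ?f p)"
    using infsum_Sigma_banach[OF sm] by simp
  also have "\<dots> = (\<Sum>\<^sub>\<infinity>T::nat. if T = 0 \<and> m \<le> 0 then 1 / qfac q (nat (- m)) else 0)"
    by (simp only: graded)
  also have "\<dots> = (\<Sum>\<^sub>\<infinity>T\<in>{0::nat}. if m \<le> 0 then 1 / qfac q (nat (- m)) else 0)"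
    by (intro infsum_cong_neutral) auto
  finally show ?thesis by simp
qed

text \<open>
The total weight of the bilateral term with index \<open>m\<close>. The right-hand side is \<open>1/(q;q)_{-m}\<close>, with
the usual convention that \<open>1/(q;q)_n\<close> is zero for negative \<open>n\<close>.
\<close>

lemma kernel_sum:
  fixes m :: int
  assumes "norm q < 1" "norm x < 1"
  shows "qpoch_inf x q * (\<Sum>\<^sub>\<infinity>(i, k, n)\<in>{(i, k, n). int k + int n - int i = m}.
      x ^ (k + n) * q ^ (i * k) * qtau q k
        / (qfac q i * qfac q k * qpoch x q (int k) * qfac q n))
    = (if m \<le> 0 then 1 / qfac q (nat (- m)) else 0)"
proof -
  let ?w = "\<lambda>i k n. x ^ (k + n) * q ^ (i * k) * qtau q k
        / (qfac q i * qfac q k * qpoch x q (int k) * qfac q n)"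
  let ?i = "\<lambda>k n. nat (int k + int n - m)"
  let ?K = "{(k, n). int k + int n \<ge> m}"
  have euler: "qpoch_inf x q * ?w i k n = (\<Sum>\<^sub>\<infinity>j. quad_term q x i k n j)" for i k n
  proof -
    have "norm (x * q ^ k) < 1"
      using assms mult_left_le[of "norm q ^ k" "norm x"] by (simp add: norm_mult norm_power power_le_one)
    then have "qpoch_inf (x * q ^ k) q = (\<Sum>\<^sub>\<infinity>j. qtau q j / qfac q j * (x * q ^ k) ^ j)"
      using euler_expansion[OF assms(1)] by (metis infsumI)
    moreover have "qpoch_inf x q / qpoch x q (int k) = qpoch_inf (x * q ^ k) q"
      using qpoch_inf_split[OF assms(1), of x k] qpoch_nonzero[OF assms, of k] by simp
    moreover have "qpoch_inf x q * ?w i k n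
        = x ^ (k + n) * q ^ (i * k) * qtau q k / (qfac q i * qfac q k * qfac q n)
          * (qpoch_inf x q / qpoch x q (int k))"
      by (simp add: mult_ac)
    ultimately have "qpoch_inf x q * ?w i k n
        = x ^ (k + n) * q ^ (i * k) * qtau q k / (qfac q i * qfac q k * qfac q n)
          * (\<Sum>\<^sub>\<infinity>j. qtau q j / qfac q j * (x * q ^ k) ^ j)"
      by (simp only:)
    also have "\<dots> = (\<Sum>\<^sub>\<infinity>j. quad_term q x i k n j)"
      unfolding infsum_cmult_right'[symmetric] quad_term_def
      by (intro infsum_cong) (simp add: power_add power_mult_distrib power_mult add_mult_distrib mult.commute[of _ k])
    finally show ?thesis .
  qed
  have "(\<Sum>\<^sub>\<infinity>(i, k, n)\<in>{(i, k, n). int k + int n - int i = m}. ?w i k n)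
      = (\<Sum>\<^sub>\<infinity>(k, n)\<in>?K. ?w (?i k n) k n)"
    by (rule infsum_reindex_bij_witness[where j = snd and i = "\<lambda>(k, n). (?i k n, k, n)"]) auto
  then have "qpoch_inf x q * (\<Sum>\<^sub>\<infinity>(i, k, n)\<in>{(i, k, n). int k + int n - int i = m}. ?w i k n)
      = (\<Sum>\<^sub>\<infinity>(k, n)\<in>?K. \<Sum>\<^sub>\<infinity>j. quad_term q x (?i k n) k n j)"
    unfolding euler[symmetric] by (simp only: infsum_cmult_right'[symmetric] case_prod_unfold)
  also have "\<dots> = (\<Sum>\<^sub>\<infinity>((k, n), j)\<in>?K \<times> UNIV. quad_term q x (?i k n) k n j)"
    using infsum_Sigma_banach[OF quad_term_summable[OF assms, of ?i "?K \<times> UNIV"]]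
    by (simp add: case_prod_unfold)
  also have "\<dots> = (if m \<le> 0 then 1 / qfac q (nat (- m)) else 0)"
    by (rule quad_term_sum[OF assms])
  finally show ?thesis .
qed

section \<open>The transformation formula\<close>

lemma qpochs_0 [simp]: "qpochs as q 0 = 1"
  by (induction as) (simp_all add: qpochs_def)

lemma qpoch_numerator_nonzero:
  fixes q \<alpha> :: complex
  assumes "q \<noteq> 0" "\<alpha> \<noteq> 0" "1 - q / \<alpha> * q ^ k \<noteq> 0"
  shows "1 - \<alpha> * q powi (- int (Suc k)) \<noteq> 0"
proof
  assume "1 - \<alpha> * q powi (- int (Suc k)) = 0"
  moreover have "q powi (- int (Suc k)) = inverse (q ^ Suc k)"
    by (simp add: power_int_minus del: of_nat_Suc)
  ultimately have "\<alpha> = q ^ Suc k"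
    using assms(1) by (simp only:) (simp add: field_simps)
  then show False using assms by simp
qed

theorem theorem3p20:
  fixes q x y :: complex and a b :: "complex list" and r :: nat
  assumes q: "0 < norm q" "norm q < 1"
    and r: "r \<ge> 1"
    and len: "length a = r + 1" "length b = r"
    and nonzero: "\<forall>\<alpha>\<in>set a. \<alpha> \<noteq> 0" "\<forall>\<beta>\<in>set b. \<beta> \<noteq> 0" "x \<noteq> 0" "y \<noteq> 0"
    and no_zero_factors:
      "\<forall>\<alpha>\<in>set a. \<forall>m::nat. 1 - q / \<alpha> * q ^ m \<noteq> 0"
      "\<forall>\<beta>\<in>set b. \<forall>m::int. 1 - \<beta> * q powi m \<noteq> 0"
      "\<forall>m::nat. 1 - x * q ^ m \<noteq> 0"
    and abs_conv_lhs:
      "summable (\<lambda>n. norm (qhyper_term (0 # map (\<lambda>\<beta>. q / \<beta>) b) (map (\<lambda>\<alpha>. q / \<alpha>) a) q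
         (q * prod_list b / (y * prod_list a)) n))"
    and abs_conv_rhs:
      "(\<lambda>(i::nat, k::nat, n::nat). norm (
          x ^ k * q ^ (i * k) * qtau q k
            / (qpoch q q (int i) * qpochs [q, x] q (int k))
          * (qpochs a q (int k - int i) / qpochs b q (int k - int i))
          * y powi (int k - int i)
          * qhyper_term (map (\<lambda>\<alpha>. q powi (int k - int i) * \<alpha>) a)
              (map (\<lambda>\<beta>. q powi (int k - int i) * \<beta>) b) q (x * y) n)) summable_on UNIV"
  shows "qhyper (0 # map (\<lambda>\<beta>. q / \<beta>) b) (map (\<lambda>\<alpha>. q / \<alpha>) a) q
           (q * prod_list b / (y * prod_list a))
         = qpoch_inf x q * (\<Sum>\<^sub>\<infinity>(i::nat, k::nat)\<in>UNIV.
             x ^ k * q ^ (i * k) * qtau q k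
               / (qpoch q q (int i) * qpochs [q, x] q (int k))
             * (qpochs a q (int k - int i) / qpochs b q (int k - int i))
             * y powi (int k - int i)
             * qhyper (map (\<lambda>\<alpha>. q powi (int k - int i) * \<alpha>) a)
                 (map (\<lambda>\<beta>. q powi (int k - int i) * \<beta>) b) q (x * y))"
proof -
  have q0: "q \<noteq> 0" using q by auto
  note nz = qfac_nonzero[OF q(2)]
  have a_shift: "1 - \<alpha> * q powi (- int (Suc k)) \<noteq> 0" if "\<alpha> \<in> set a" for \<alpha> k
    using that nonzero(1) no_zero_factors(1) by (intro qpoch_numerator_nonzero[OF q0]) auto
  have b_shift: "1 - \<beta> * q powi (- int (Suc k)) \<noteq> 0" if "\<beta> \<in> set b" for \<beta> k
    using that no_zero_factors(2) by blast
  \<comment> \<open>The bilateral sequence, the weight, and the summand of the triple series.\<close>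
  define c where "c m = qpochs a q m / qpochs b q m * y powi m" for m :: int
  define w where "w i k n = x ^ (k + n) * q ^ (i * k) * qtau q k
    / (qfac q i * qfac q k * qpoch x q (int k) * qfac q n)" for i k n :: nat
  define g where "g = (\<lambda>(i::nat, k::nat, n::nat). c (int k + int n - int i) * w i k n)"
  define A where "A i k = x ^ k * q ^ (i * k) * qtau q k / (qpoch q q (int i) * qpochs [q, x] q (int k))
    * (qpochs a q (int k - int i) / qpochs b q (int k - int i)) * y powi (int k - int i)" for i k :: nat
  define h where "h i k = qhyper_term (map (\<lambda>\<alpha>. q powi (int k - int i) * \<alpha>) a)
    (map (\<lambda>\<beta>. q powi (int k - int i) * \<beta>) b) q (x * y)" for i k :: nat
  have g_eq: "A i k * h i k n = g (i, k, n)" for i k n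
  proof -
    define N where "N = int k - int i"
    have N: "int k + int n - int i = N + int n" unfolding N_def by simp
    have h: "h i k n = qpochs (map (\<lambda>\<alpha>. q powi N * \<alpha>) a) q (int n)
        / qpochs (map (\<lambda>\<beta>. q powi N * \<beta>) b) q (int n) * ((x * y) ^ n / qfac q n)"
      unfolding h_def qhyper_term_def N_def using len by simp
    have c: "c (N + int n) = qpochs a q N / qpochs b q N * y powi N
        * (qpochs (map (\<lambda>\<alpha>. q powi N * \<alpha>) a) q (int n)
        / qpochs (map (\<lambda>\<beta>. q powi N * \<beta>) b) q (int n)) * y ^ n"
    proof -
      have "qpochs a q (N + int n) = qpochs a q N * qpochs (map (\<lambda>\<alpha>. q powi N * \<alpha>) a) q (int n)"
        by (rule qpochs_add[OF q0 a_shift])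
      moreover have "qpochs b q (N + int n) = qpochs b q N * qpochs (map (\<lambda>\<beta>. q powi N * \<beta>) b) q (int n)"
        by (rule qpochs_add[OF q0 b_shift])
      ultimately show ?thesis
        unfolding c_def using nonzero(4) by (simp add: power_int_add)
    qed
    have "qpochs [q, x] q (int k) = qfac q k * qpoch x q (int k)"
      by (simp add: qpochs_def)
    then show ?thesis
      unfolding g_def A_def w_def prod.case h N c N_def[symmetric]
      by (simp add: power_mult_distrib power_add mult_ac)
  qed
  have "(\<lambda>p. norm (g p)) summable_on UNIV"
    using abs_conv_rhs unfolding A_def[symmetric] h_def[symmetric] g_eq
    by (simp add: case_prod_unfold)
  then have g_abs: "g abs_summable_on UNIV" .
  then have g_summable: "g summable_on B" for B
    using abs_summable_summable summable_on_subset_banach by blast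
  \<comment> \<open>The terms with \<open>k = 0\<close> and \<open>n = i\<close> form a subseries comparable to the geometric series in \<open>x\<close>.\<close>
  have x: "norm x < 1"
  proof -
    have "Bseq (\<lambda>n. qfac q n)"
      using qpoch_LIMSEQ[OF q(2)] by (intro convergent_imp_Bseq convergentI)
    then obtain C where C: "C > 0" "\<And>n. norm (qfac q n) \<le> C" unfolding Bseq_def by blast
    have "(\<lambda>p. norm (g p)) summable_on range (\<lambda>i. (i, 0, i))"
      using g_abs by (rule summable_on_subset_banach) simp
    then have "(\<lambda>i. norm (g (i, 0, i))) summable_on UNIV"
      by (subst (asm) summable_on_reindex) (auto simp: inj_on_def o_def)
    then have "summable (\<lambda>i. C * C * norm (g (i, 0, i)))"
      by (intro summable_mult summable_on_imp_summable)
    then have "summable (\<lambda>i. norm x ^ i)"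
    proof (rule summable_comparison_test[rotated], intro exI allI impI)
      fix i :: nat
      have "g (i, 0, i) = x ^ i / (qfac q i * qfac q i)"
        unfolding g_def c_def w_def by simp
      then have "norm x ^ i = norm (qfac q i) * norm (qfac q i) * norm (g (i, 0, i))"
        using nz[of i] by (simp add: norm_mult norm_divide norm_power)
      also have "\<dots> \<le> C * C * norm (g (i, 0, i))"
        using C by (intro mult_right_mono mult_mono) auto
      finally show "norm (norm x ^ i) \<le> C * C * norm (g (i, 0, i))" by simp
    qed
    then show ?thesis by (simp add: summable_geometric_iff)
  qed
  have inner: "A i k * qhyper (map (\<lambda>\<alpha>. q powi (int k - int i) * \<alpha>) a)
      (map (\<lambda>\<beta>. q powi (int k - int i) * \<beta>) b) q (x * y) = (\<Sum>\<^sub>\<infinity>n. g (i, k, n))" for i k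
  \<comment> \<open>If the prefactor vanishes, nothing is known about the convergence of the inner series,
    but both sides are zero.\<close>
  proof (cases "A i k = 0")
    case True
    then show ?thesis unfolding g_eq[symmetric] by simp
  next
    case False
    have "(\<lambda>n. g (i, k, n)) summable_on UNIV"
      using g_summable[of "range (\<lambda>n. (i, k, n))"]
      by (subst (asm) summable_on_reindex) (auto simp: inj_on_def o_def)
    then have "((\<lambda>n. A i k * h i k n) has_sum (\<Sum>\<^sub>\<infinity>n. g (i, k, n))) UNIV"
      unfolding g_eq by (rule has_sum_infsum)
    then have sums: "(\<lambda>n. A i k * h i k n) sums (\<Sum>\<^sub>\<infinity>n. g (i, k, n))"
      by (rule has_sum_imp_sums)
    then have "summable (h i k)"
      using False by (auto dest: sums_summable simp: summable_cmult_iff)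
    then have "(\<lambda>n. A i k * h i k n) sums (A i k * suminf (h i k))"
      by (intro sums_mult summable_sums)
    with sums show ?thesis
      unfolding qhyper_def h_def[symmetric] by (rule sums_unique2[symmetric])
  qed
  have assoc: "bij_betw (\<lambda>((i, k), n). (i, k, n)) (UNIV \<times> UNIV) (UNIV :: (nat \<times> nat \<times> nat) set)"
    by (rule bij_betwI[where g = "\<lambda>(i, k, n). ((i, k), n)"]) auto
  have "(\<Sum>\<^sub>\<infinity>(i, k)\<in>UNIV. A i k * qhyper (map (\<lambda>\<alpha>. q powi (int k - int i) * \<alpha>) a)
      (map (\<lambda>\<beta>. q powi (int k - int i) * \<beta>) b) q (x * y))
      = (\<Sum>\<^sub>\<infinity>p\<in>UNIV. \<Sum>\<^sub>\<infinity>n. g ((\<lambda>((i, k), n). (i, k, n)) (p, n)))"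
    unfolding inner by (simp add: case_prod_unfold)
  also have "\<dots> = (\<Sum>\<^sub>\<infinity>p\<in>UNIV \<times> UNIV. g ((\<lambda>((i, k), n). (i, k, n)) p))"
    by (rule infsum_Sigma_banach) (use g_summable in \<open>simp only: summable_on_reindex_bij_betw[OF assoc]\<close>)
  also have "\<dots> = infsum g UNIV"
    by (rule infsum_reindex_bij_betw[OF assoc])
  finally have total: "(\<Sum>\<^sub>\<infinity>(i, k)\<in>UNIV. A i k * qhyper (map (\<lambda>\<alpha>. q powi (int k - int i) * \<alpha>) a)
      (map (\<lambda>\<beta>. q powi (int k - int i) * \<beta>) b) q (x * y)) = infsum g UNIV" .
  \<comment> \<open>Regrouping along the fibres of \<open>k + n - i\<close>.\<close>
  define F where "F m = {(i::nat, k::nat, n::nat). int k + int n - int i = m}" for m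
  have fibres: "bij_betw snd (Sigma UNIV F) UNIV"
    unfolding F_def by (rule bij_betwI[where g = "\<lambda>(i, k, n). (int k + int n - int i, i, k, n)"]) auto
  have "infsum g UNIV = (\<Sum>\<^sub>\<infinity>p\<in>Sigma UNIV F. g (snd p))"
    by (rule infsum_reindex_bij_betw[OF fibres, symmetric])
  also have "\<dots> = (\<Sum>\<^sub>\<infinity>m. \<Sum>\<^sub>\<infinity>p\<in>F m. g p)"
    using infsum_Sigma_banach[of "\<lambda>p. g (snd p)" UNIV F] g_summable
    by (simp add: summable_on_reindex_bij_betw[OF fibres])
  also have "\<dots> = (\<Sum>\<^sub>\<infinity>m. c m * (\<Sum>\<^sub>\<infinity>(i, k, n)\<in>F m. w i k n))"
    unfolding infsum_cmult_right'[symmetric]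
    by (intro infsum_cong) (auto simp: g_def F_def)
  finally have "qpoch_inf x q * infsum g UNIV
      = (\<Sum>\<^sub>\<infinity>m. c m * (qpoch_inf x q * (\<Sum>\<^sub>\<infinity>(i, k, n)\<in>F m. w i k n)))"
    by (simp add: infsum_cmult_right'[symmetric] mult_ac)
  also have "\<dots> = (\<Sum>\<^sub>\<infinity>m. c m * (if m \<le> 0 then 1 / qfac q (nat (- m)) else 0))"
    unfolding F_def w_def kernel_sum[OF q(2) x] ..
  also have "\<dots> = (\<Sum>\<^sub>\<infinity>m\<in>{..0}. c m / qfac q (nat (- m)))"
    by (rule infsum_cong_neutral) auto
  also have "\<dots> = (\<Sum>\<^sub>\<infinity>N. c (- int N) / qfac q N)"
    by (rule infsum_reindex_bij_witness[where j = "\<lambda>m. nat (- m)" and i = "\<lambda>N. - int N"]) auto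
  also have "\<dots> = (\<Sum>\<^sub>\<infinity>N. qhyper_term (0 # map (\<lambda>\<beta>. q / \<beta>) b) (map (\<lambda>\<alpha>. q / \<alpha>) a) q
      (q * prod_list b / (y * prod_list a)) N)"
  proof (rule infsum_cong)
    fix N :: nat
    let ?t = "qtau q N * q ^ N"
    let ?a = "qpochs (map (\<lambda>\<alpha>. q / \<alpha>) a) q (int N)" and ?b = "qpochs (map (\<lambda>\<beta>. q / \<beta>) b) q (int N)"
    have t0: "qtau q N \<noteq> 0" using q0 by (simp add: qtau_def)
    have prods: "prod_list a \<noteq> 0" "prod_list b \<noteq> 0"
      using nonzero by (auto simp: prod_list_zero_iff)
    \<comment> \<open>Since \<open>a\<close> has one entry more than \<open>b\<close>, the quotient of the two reflections leaves
      exactly one factor \<open>\<tau>(N) q^N\<close>.\<close>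
    have A: "qpochs a q (- int N) * ?a = ?t ^ (r + 1) / prod_list a ^ N"
      using qpochs_uminus[OF q0 _ a_shift, of a N] nonzero(1) len by simp
    have B: "qpochs b q (- int N) * ?b = ?t ^ r / prod_list b ^ N"
      using qpochs_uminus[OF q0 _ b_shift, of b N] nonzero(2) len by simp
    have nonz: "?a \<noteq> 0" "?b \<noteq> 0" "qpochs b q (- int N) \<noteq> 0"
      using A B t0 q0 prods by auto
    have "qpochs a q (- int N) / qpochs b q (- int N)
        = ?b / ?a * ((qpochs a q (- int N) * ?a) / (qpochs b q (- int N) * ?b))"
      using nonz by simp
    also have "\<dots> = ?b / ?a * (?t * (prod_list b / prod_list a) ^ N)"
      unfolding A B using t0 q0 prods by (simp add: power_divide)
    finally have "c (- int N) / qfac q N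
        = ?b / ?a * qtau q N * ((q * prod_list b / (y * prod_list a)) ^ N / qfac q N)"
      unfolding c_def by (simp add: power_int_minus power_divide power_mult_distrib power_inverse divide_inverse mult_ac)
    moreover have "qpochs (0 # map (\<lambda>\<beta>. q / \<beta>) b) q (int N) = ?b"
      by (simp add: qpochs_def qpoch_of_nat)
    ultimately show "c (- int N) / qfac q N = qhyper_term (0 # map (\<lambda>\<beta>. q / \<beta>) b)
        (map (\<lambda>\<alpha>. q / \<alpha>) a) q (q * prod_list b / (y * prod_list a)) N"
      unfolding qhyper_term_def using len by simp
  qed
  also have "\<dots> = qhyper (0 # map (\<lambda>\<beta>. q / \<beta>) b) (map (\<lambda>\<alpha>. q / \<alpha>) a) q
      (q * prod_list b / (y * prod_list a))"
    unfolding qhyper_def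
    using norm_summable_imp_has_sum[OF abs_conv_lhs summable_sums[OF summable_norm_cancel[OF abs_conv_lhs]]]
    by (rule infsumI)
  finally show ?thesis
    unfolding total[symmetric] A_def by simp
qed

end
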